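(* For every real $0\le\eta<0.5$ there exists a constant $\gamma=\gamma(\eta)>0$ such that for every positive integer $n$ and every real $0<\epsilon<1$ there exists a polynomial $p=p_{n,\eta,\epsilon}$ in the entries of an $n\times n$ complex matrix $A=(a_{ij})$ such that $\deg p\le\gamma(\ln n-\ln\epsilon)$ and $$\left|\ln\operatorname{per}A-p(A)\right|\le\epsilon$$ for all $n\times n$ complex matrices $A=(a_{ij})$ satisfying $|1-a_{ij}|\le\eta$ for all $i,j$.
   Context: The permanent of an $n\times n$ matrix $A=(a_{ij})$ is $\operatorname{per}A=\sum_{\sigma\in S_n}\prod_{i=1}^n a_{i\sigma(i)}$, where $S_n$ is the symmetric group of permutations of $\{1,\dots,n\}$. Branch of the logarithm: let $D$ be the convex set of all $n\times n$ complex matrices $Z=(z_{ij})$ with $|1-z_{ij}|\le 0.5$ for all $i,j$. The permanent has no zeros on $D$, and $\ln\operatorname{per}$ denotes the continuous branch on $D$ (a continuous function $L$ with $e^{L(Z)}=\operatorname{per}Z$) which is real at real matrices; in particular its value at the all-ones matrix is the real number $\ln n!$. *)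

theory Defs
  imports
    "HOL-Analysis.Analysis"
    "HOL-Library.Poly_Mapping"
    "HOL-Combinatorics.Permutations"
    "Jordan_Normal_Form.Matrix"
begin

definition permanent :: "'a::comm_semiring_1 mat \<Rightarrow> 'a" where
  "permanent A =
    (\<Sum>\<sigma> | \<sigma> permutes {0..<dim_row A}. \<Prod>i = 0..<dim_row A. A $$ (i, \<sigma> i))"

definition matrix_polydisc :: "nat \<Rightarrow> real \<Rightarrow> complex mat set" where
  "matrix_polydisc n r = {A \<in> carrier_mat n n. \<forall>i<n. \<forall>j<n. cmod (1 - A $$ (i, j)) \<le> r}"

text \<open>
  The type of matrices carries no topology in the library. Continuity of a function of an
  \<open>n \<times> n\<close> matrix is continuity in the entries: \<open>f\<close> below is a family of entries in the
  product topology, and \<open>mat n n f\<close> only depends on its values at indices below \<open>n\<close>.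
\<close>
definition mat_continuous_on :: "nat \<Rightarrow> complex mat set \<Rightarrow> (complex mat \<Rightarrow> complex) \<Rightarrow> bool" where
  "mat_continuous_on n S L \<longleftrightarrow>
    continuous_on {f :: nat \<times> nat \<Rightarrow> complex. mat n n f \<in> S} (\<lambda>f. L (mat n n f))"

definition is_ln_permanent_branch :: "nat \<Rightarrow> (complex mat \<Rightarrow> complex) \<Rightarrow> bool" where
  "is_ln_permanent_branch n L \<longleftrightarrow>
    mat_continuous_on n (matrix_polydisc n (1/2)) L \<and>
    (\<forall>Z \<in> matrix_polydisc n (1/2). exp (L Z) = permanent Z) \<and>
    (\<forall>Z \<in> matrix_polydisc n (1/2). (\<forall>i<n. \<forall>j<n. Z $$ (i, j) \<in> \<real>) \<longrightarrow> L Z \<in> \<real>)"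

text \<open>
  Membership in \<open>extensional\<close> fixes the value outside the domain, so that the branch is
  unique as a total HOL function.
\<close>
definition ln_permanent :: "nat \<Rightarrow> complex mat \<Rightarrow> complex" where
  "ln_permanent n =
    (THE L. L \<in> extensional (matrix_polydisc n (1/2)) \<and> is_ln_permanent_branch n L)"

text \<open>
  Polynomials in the entries of a matrix: the variables are the index pairs, a monomial maps
  variables to exponents, and a polynomial maps monomials to coefficients.
\<close>
type_synonym entry_monom = "(nat \<times> nat) \<Rightarrow>\<^sub>0 nat"
type_synonym entry_poly = "entry_monom \<Rightarrow>\<^sub>0 complex"

definition entry_poly_vars :: "entry_poly \<Rightarrow> (nat \<times> nat) set" where
  "entry_poly_vars p = (\<Union>m \<in> Poly_Mapping.keys p. Poly_Mapping.keys m)"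

definition entry_monom_degree :: "entry_monom \<Rightarrow> nat" where
  "entry_monom_degree m = (\<Sum>v \<in> Poly_Mapping.keys m. Poly_Mapping.lookup m v)"

text \<open>Total degree; the zero polynomial gets degree \<open>0\<close>.\<close>
definition entry_poly_degree :: "entry_poly \<Rightarrow> nat" where
  "entry_poly_degree p = Max (insert 0 (entry_monom_degree ` Poly_Mapping.keys p))"

definition entry_poly_eval :: "entry_poly \<Rightarrow> complex mat \<Rightarrow> complex" where
  "entry_poly_eval p A =
    (\<Sum>m \<in> Poly_Mapping.keys p. Poly_Mapping.lookup p m *
      (\<Prod>v \<in> Poly_Mapping.keys m. (A $$ v) ^ Poly_Mapping.lookup m v))"

end

theory Submission
  imports Defs "HOL-Computational_Algebra.Fundamental_Theorem_Algebra"
begin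

text \<open>
The logarithm of the permanent is approximated by a truncated Taylor series, whose length is
controlled by a zero-free region of the permanent.

\<^emph>\<open>Zero-freeness.\<close> If plane vectors enclose pairwise angles of at most \<open>\<pi>/2\<close>, then
their sum \<open>U\<close> has length at least \<open>1 / sqrt 2\<close> times the sum of their lengths. Linear combinations
with coefficients within \<open>1/2\<close> of \<open>1\<close> therefore stay in the cone of angle \<open>\<pi>/4\<close> around \<open>U\<close>,
and again any two of them enclose an angle of at most \<open>\<pi>/2\<close> (\<open>acute_combination\<close>). Applied to
Laplace expansions, alternately along rows and columns, this shows that permanents of two
matrices in the polydisc of radius \<open>1/2\<close> that differ in a single row are nonzero and enclose
an angle of at most \<open>\<pi>/2\<close> (\<open>acute_minors\<close>, \<open>acute_permanent_row_change\<close>).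

\<^emph>\<open>The branch.\<close> The same angle bound gives an explicit continuous logarithm: change the all-ones
matrix \<open>J\<close> into \<open>Z\<close> row by row and add the principal logarithms of the successive quotients.
Uniqueness follows from the path from \<open>J\<close> to \<open>Z\<close>, because continuous logarithms that agree at
the start of a path agree at its end.

\<^emph>\<open>The polynomial.\<close> Let \<open>g t\<close> be the permanent of \<open>J + t (A - J)\<close>, a polynomial of degree at most
\<open>n\<close> in \<open>t\<close> with \<open>g 0 = n!\<close>. If \<open>\<eta> > 0\<close>, which is no restriction, and the
entries of \<open>A\<close> are within \<open>\<eta>\<close> of \<open>1\<close>, then zero-freeness puts
the roots of \<open>g\<close> outside the disc of radius \<open>1 / (2 * \<eta>)\<close>. Hence \<open>g t = n! * (\<Prod>i<n. 1 - t * w i)\<close> with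
\<open>cmod (w i) \<le> \<rho> = 2 * \<eta> < 1\<close>, and the branch at \<open>A\<close> is \<open>ln n! + (\<Sum>i<n. Ln (1 - w i))\<close>.
Cutting the logarithmic series after \<open>m\<close> terms leaves an error of at most
\<open>n * \<rho> ^ Suc m / (1 - \<rho>)\<close>, which is below \<open>\<epsilon>\<close> once \<open>m\<close> is of the order \<open>ln n - ln \<epsilon>\<close>. What
remains is a combination of power sums of the \<open>w i\<close>. By Newton's identities the \<open>k\<close>-th power sum is
a polynomial in the first \<open>k\<close> coefficients of \<open>g\<close>, and the \<open>j\<close>-th coefficient of \<open>g\<close> is a
polynomial of degree at most \<open>j\<close> in the entries of \<open>A\<close>; so the \<open>k\<close>-th power sum has
degree at most \<open>k\<close> (\<open>entry_polynomial_power_sum\<close>).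
\<close>

section \<open>Acute configurations in the complex plane\<close>

text \<open>
Two nonzero complex numbers, seen as vectors in the plane, enclose an angle of at most
\<open>\<pi>/2\<close>: \<open>Re (cnj x * y)\<close> is their inner product.
\<close>
definition acute :: "complex \<Rightarrow> complex \<Rightarrow> bool" where
  "acute x y \<longleftrightarrow> x \<noteq> 0 \<and> y \<noteq> 0 \<and> 0 \<le> Re (cnj x * y)"

text \<open>
Pairwise acute vectors lie in a common quarter plane, so one of them is the first one met when
the cone that they span is swept counterclockwise. The induction works because, once all
vectors have nonnegative real part in the frame of \<open>a\<close>, comparing a third vector with \<open>c\<close>
instead of \<open>a\<close> is the expansion of \<open>Im (cnj (cnj a * c) * (cnj a * y))\<close>.
\<close>
lemma extreme_ray:
  assumes "finite S" "S \<noteq> {}" and "\<And>x y. x \<in> S \<Longrightarrow> y \<in> S \<Longrightarrow> acute x y"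
  shows "\<exists>x\<in>S. \<forall>y\<in>S. 0 \<le> Im (cnj x * y)"
  using assms
proof (induction S rule: finite_ne_induct)
  case (singleton x)
  then show ?case by (simp add: algebra_simps)
next
  case (insert c S)
  obtain a where a: "a \<in> S" "\<And>y. y \<in> S \<Longrightarrow> 0 \<le> Im (cnj a * y)"
    using insert.IH insert.prems by (metis insertCI)
  have Re_nonneg: "0 \<le> Re (cnj a * y)" if "y \<in> insert c S" for y
    using insert.prems[of a y] a(1) that by (simp add: acute_def)
  show ?case
  proof (cases "0 \<le> Im (cnj a * c)")
    case True
    then show ?thesis using a by (intro bexI[of _ a]) auto
  next
    case False
    have "0 \<le> Im (cnj c * y)" if y: "y \<in> S" for y
    proof -
      have "(cmod a)\<^sup>2 * Im (cnj c * y)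
          = Re (cnj a * c) * Im (cnj a * y) - Im (cnj a * c) * Re (cnj a * y)"
        unfolding cmod_power2 by (simp add: algebra_simps power2_eq_square)
      also have "\<dots> \<ge> 0"
        using False a(2)[OF y] Re_nonneg[of y] Re_nonneg[of c] y
        by (smt (verit) insertCI mult_nonneg_nonneg mult_nonpos_nonneg)
      finally have "0 \<le> (cmod a)\<^sup>2 * Im (cnj c * y)" .
      moreover have "a \<noteq> 0" using insert.prems[of a a] a(1) by (simp add: acute_def)
      ultimately show ?thesis by (simp add: zero_le_mult_iff)
    qed
    moreover have "0 \<le> Im (cnj c * c)" by (simp add: algebra_simps)
    ultimately show ?thesis by blast
  qed
qed

text \<open>
After rotation by an extreme vector all the \<open>u i\<close> lie in the closed first quadrant, where
the norm is at most the sum of the coordinates. Coordinates add up linearly, and for a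
single vector their sum is at most \<open>sqrt 2\<close> times the norm.
\<close>
lemma sum_norm_le_sqrt2_norm_sum:
  assumes "finite S" and "\<And>i j. i \<in> S \<Longrightarrow> j \<in> S \<Longrightarrow> acute (u i) (u j)"
  shows "(\<Sum>i\<in>S. cmod (u i)) \<le> sqrt 2 * cmod (\<Sum>i\<in>S. u i)"
proof (cases "S = {}")
  case False
  have "\<exists>x\<in>u ` S. \<forall>y\<in>u ` S. 0 \<le> Im (cnj x * y)"
    using assms False by (intro extreme_ray) auto
  then obtain k where k: "k \<in> S" "\<And>i. i \<in> S \<Longrightarrow> 0 \<le> Im (cnj (u k) * u i)"
    by auto
  define w where "w i = cnj (u k) * u i" for i
  have w: "0 \<le> Re (w i)" "0 \<le> Im (w i)" if "i \<in> S" for i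
    using k assms(2)[OF k(1) that] that by (simp_all add: w_def acute_def)
  have "cmod (u k) * (\<Sum>i\<in>S. cmod (u i)) = (\<Sum>i\<in>S. cmod (w i))"
    by (simp add: w_def norm_mult sum_distrib_left)
  also have "\<dots> \<le> (\<Sum>i\<in>S. Re (w i) + Im (w i))"
    using w by (intro sum_mono) (metis abs_of_nonneg cmod_le)
  also have "\<dots> = Re (sum w S) + Im (sum w S)"
    by (simp add: sum.distrib)
  also have "\<dots> \<le> sqrt 2 * cmod (sum w S)"
    using complex_abs_le_norm[of "sum w S"] by linarith
  also have "sum w S = cnj (u k) * sum u S"
    by (simp add: w_def sum_distrib_left)
  also have "sqrt 2 * cmod \<dots> = cmod (u k) * (sqrt 2 * cmod (sum u S))"
    by (simp add: norm_mult)
  finally show ?thesis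
    using assms(2)[OF k(1) k(1)] by (simp add: acute_def)
qed simp

text \<open>
The disc around \<open>u\<close> of radius \<open>cmod u / sqrt 2\<close> touches the two rays at angle \<open>\<pi>/4\<close> on
either side of \<open>u\<close>, and therefore lies in a quarter plane.
\<close>
lemma acute_of_near:
  assumes "u \<noteq> 0" "sqrt 2 * cmod (v - u) \<le> cmod u" "sqrt 2 * cmod (w - u) \<le> cmod u"
  shows "acute v w"
proof -
  \<comment> \<open>In the frame where \<open>u\<close> is \<open>1\<close>, the quarter plane is \<open>\<bar>Im z\<bar> \<le> Re z\<close>.\<close>
  have cone: "\<bar>Im (z / u)\<bar> \<le> Re (z / u) \<and> z \<noteq> 0" if "sqrt 2 * cmod (z - u) \<le> cmod u" for z
  proof -
    have "z / u - 1 = (z - u) / u"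
      using assms(1) by (simp add: field_simps)
    then have "sqrt 2 * cmod (z / u - 1) \<le> 1"
      using that assms(1) by (simp add: norm_divide)
    moreover have "\<bar>Re (z / u - 1)\<bar> + \<bar>Im (z / u - 1)\<bar> \<le> sqrt 2 * cmod (z / u - 1)"
      by (rule complex_abs_le_norm)
    ultimately have "\<bar>Re (z / u) - 1\<bar> + \<bar>Im (z / u)\<bar> \<le> 1" by simp
    moreover have "z \<noteq> 0"
    proof
      assume "z = 0"
      with that have "sqrt 2 * cmod u \<le> 1 * cmod u" by simp
      then have "sqrt 2 \<le> 1" using assms(1) mult_le_cancel_right_pos zero_less_norm_iff by blast
      then show False by simp
    qed
    ultimately show ?thesis by linarith
  qed
  define p q where "p = v / u" and "q = w / u"
  have vw: "v = u * p" "w = u * q" using assms(1) by (simp_all add: p_def q_def)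
  have p: "\<bar>Im p\<bar> \<le> Re p" and q: "\<bar>Im q\<bar> \<le> Re q"
    using cone assms by (auto simp: p_def q_def)
  have "cnj v * w = of_real ((cmod u)\<^sup>2) * (cnj p * q)"
    by (simp add: vw complex_norm_square[unfolded of_real_power] algebra_simps)
  then have "Re (cnj v * w) = (cmod u)\<^sup>2 * (Re p * Re q + Im p * Im q)"
    by (simp only: Re_complex_of_real times_complex.sel) simp
  moreover have "\<bar>Im p * Im q\<bar> \<le> Re p * Re q"
    unfolding abs_mult using p q by (intro mult_mono) auto
  ultimately show ?thesis
    using cone assms by (auto simp: acute_def)
qed

text \<open>
This is where the radius \<open>1/2\<close> comes from: replacing the coefficients \<open>1\<close> by coefficients at
distance at most \<open>\<delta>\<close> moves the sum \<open>U\<close> of the vectors by at most \<open>\<delta> * sqrt 2 * cmod U\<close>, and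
this is at most \<open>cmod U / sqrt 2\<close> exactly for \<open>\<delta> \<le> 1/2\<close>.
\<close>
lemma acute_combination:
  assumes "finite S" "S \<noteq> {}" and u: "\<And>i j. i \<in> S \<Longrightarrow> j \<in> S \<Longrightarrow> acute (u i) (u j)"
    and a: "\<And>i. i \<in> S \<Longrightarrow> cmod (1 - a i) \<le> 1/2"
    and b: "\<And>i. i \<in> S \<Longrightarrow> cmod (1 - b i) \<le> 1/2"
  shows "acute (\<Sum>i\<in>S. a i * u i) (\<Sum>i\<in>S. b i * u i)"
proof -
  define U where "U = sum u S"
  have le: "(\<Sum>i\<in>S. cmod (u i)) \<le> sqrt 2 * cmod U"
    unfolding U_def using assms(1) u by (rule sum_norm_le_sqrt2_norm_sum)
  have near: "sqrt 2 * cmod ((\<Sum>i\<in>S. c i * u i) - U) \<le> cmod U"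
    if c: "\<And>i. i \<in> S \<Longrightarrow> cmod (1 - c i) \<le> 1/2" for c
  proof -
    have "cmod ((\<Sum>i\<in>S. c i * u i) - U) = cmod (\<Sum>i\<in>S. (c i - 1) * u i)"
      by (simp add: U_def sum_subtractf algebra_simps)
    also have "\<dots> \<le> (\<Sum>i\<in>S. 1/2 * cmod (u i))"
      using c by (intro sum_norm_le) (simp only: norm_mult norm_minus_commute mult_right_mono norm_ge_zero)
    also have "\<dots> \<le> 1/2 * (sqrt 2 * cmod U)"
      using le by (subst sum_distrib_left[symmetric]) simp
    finally have "sqrt 2 * cmod ((\<Sum>i\<in>S. c i * u i) - U) \<le> sqrt 2 * (1/2 * (sqrt 2 * cmod U))"
      by (rule mult_left_mono) simp
    also have "\<dots> = sqrt 2 * sqrt 2 / 2 * cmod U" by (simp only: mult_ac times_divide_eq_right times_divide_eq_left mult_1_left)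
    also have "\<dots> = cmod U" by simp
    finally show ?thesis .
  qed
  obtain k where "k \<in> S" using assms(2) by blast
  then have "0 < (\<Sum>i\<in>S. cmod (u i))"
    using assms(1) u by (intro sum_pos2[of S k]) (auto simp: acute_def)
  then have "U \<noteq> 0" using le by auto
  then show ?thesis using near a b by (intro acute_of_near) auto
qed

section \<open>Laplace expansion and acute minors\<close>

text \<open>
The minors of a matrix are indexed by a set of rows and a set of columns that need not be
initial segments, so the permanent is needed for arbitrary finite index sets of equal size.
The extensional function space makes every bijection count once.
\<close>
definition bijections :: "'a set \<Rightarrow> 'b set \<Rightarrow> ('a \<Rightarrow> 'b) set" where
  "bijections R C = {\<sigma> \<in> R \<rightarrow>\<^sub>E C. bij_betw \<sigma> R C}"

definition permanent_on :: "'a set \<Rightarrow> 'b set \<Rightarrow> ('a \<Rightarrow> 'b \<Rightarrow> complex) \<Rightarrow> complex" where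
  "permanent_on R C f = (\<Sum>\<sigma>\<in>bijections R C. \<Prod>i\<in>R. f i (\<sigma> i))"

lemma finite_bijections: "finite R \<Longrightarrow> finite C \<Longrightarrow> finite (bijections R C)"
  unfolding bijections_def by (rule finite_subset[of _ "R \<rightarrow>\<^sub>E C"]) (auto intro: finite_PiE)

lemma restrict_mem_bijections: "bij_betw \<sigma> R C \<Longrightarrow> restrict \<sigma> R \<in> bijections R C"
  by (auto simp: bijections_def bij_betw_def)

lemma permanent_on_empty [simp]: "permanent_on {} {} (f :: 'a \<Rightarrow> 'b \<Rightarrow> complex) = 1"
proof -
  have "bijections {} {} = {\<lambda>_ :: 'a. undefined :: 'b}"
    by (auto simp: bijections_def bij_betw_def)
  then show ?thesis by (simp add: permanent_on_def)
qed

lemma permanent_on_cong: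
  "(\<And>i j. i \<in> R \<Longrightarrow> j \<in> C \<Longrightarrow> f i j = g i j) \<Longrightarrow> permanent_on R C f = permanent_on R C g"
  unfolding permanent_on_def bijections_def by (intro sum.cong prod.cong) auto

text \<open>
Inverting the bijections exchanges rows and columns, which turns the row expansion into the
column expansion.
\<close>
lemma permanent_on_transpose: "permanent_on R C f = permanent_on C R (\<lambda>j i. f i j)"
  unfolding permanent_on_def
proof (rule sum.reindex_bij_witness[of _ "\<lambda>\<tau>. restrict (inv_into C \<tau>) R" "\<lambda>\<sigma>. restrict (inv_into R \<sigma>) C"])
  have inv: "restrict (inv_into C (restrict (inv_into R \<sigma>) C)) R = \<sigma>"
    and mem: "restrict (inv_into R \<sigma>) C \<in> bijections C R"
    if "\<sigma> \<in> bijections R C" for R :: "'c set" and C :: "'d set" and \<sigma>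
  proof -
    have \<sigma>: "\<sigma> \<in> R \<rightarrow>\<^sub>E C" "bij_betw \<sigma> R C" using that by (auto simp: bijections_def)
    show "restrict (inv_into R \<sigma>) C \<in> bijections C R"
      using bij_betw_inv_into[OF \<sigma>(2)] by (rule restrict_mem_bijections)
    then have b: "bij_betw (restrict (inv_into R \<sigma>) C) C R"
      by (simp add: bijections_def)
    show "restrict (inv_into C (restrict (inv_into R \<sigma>) C)) R = \<sigma>"
    proof (rule extensionalityI[of _ R])
      fix r assume r: "r \<in> R"
      have "restrict (inv_into R \<sigma>) C (\<sigma> r) = r"
        using r \<sigma> by (auto simp: bij_betw_def)
      then show "restrict (inv_into C (restrict (inv_into R \<sigma>) C)) R r = \<sigma> r"
        using r \<sigma> b by (metis PiE_mem bij_betw_def inv_into_f_f restrict_apply')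
    qed (use \<sigma> in \<open>auto simp: PiE_def\<close>)
  qed
  show "\<And>\<sigma>. \<sigma> \<in> bijections R C \<Longrightarrow> restrict (inv_into C (restrict (inv_into R \<sigma>) C)) R = \<sigma>"
    by (rule inv)
  show "\<And>\<tau>. \<tau> \<in> bijections C R \<Longrightarrow> restrict (inv_into R (restrict (inv_into C \<tau>) R)) C = \<tau>"
    by (rule inv)
  show "\<And>\<sigma>. \<sigma> \<in> bijections R C \<Longrightarrow> restrict (inv_into R \<sigma>) C \<in> bijections C R"
    by (rule mem)
  show "\<And>\<tau>. \<tau> \<in> bijections C R \<Longrightarrow> restrict (inv_into C \<tau>) R \<in> bijections R C"
    by (rule mem)
  fix \<sigma> assume "\<sigma> \<in> bijections R C"
  then have \<sigma>: "bij_betw \<sigma> R C" by (auto simp: bijections_def)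
  have "(\<Prod>i\<in>R. f i (\<sigma> i)) = (\<Prod>i\<in>R. f (restrict (inv_into R \<sigma>) C (\<sigma> i)) (\<sigma> i))"
    using \<sigma> by (intro prod.cong) (auto simp: bij_betw_def)
  also have "\<dots> = (\<Prod>j\<in>C. f (restrict (inv_into R \<sigma>) C j) j)"
    by (rule prod.reindex_bij_betw[OF \<sigma>])
  finally show "(\<Prod>j\<in>C. f (restrict (inv_into R \<sigma>) C j) j) = (\<Prod>i\<in>R. f i (\<sigma> i))" ..
qed

text \<open>
A bijection amounts to its value at \<open>r\<close> together with a bijection between the remaining rows and
columns.
\<close>
lemma permanent_on_expand_row:
  assumes "finite R" "finite C" "r \<in> R"
  shows "permanent_on R C f = (\<Sum>c\<in>C. f r c * permanent_on (R - {r}) (C - {c}) f)"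
proof -
  have fin: "finite (bijections (R - {r}) (C - {c}))" for c
    using assms by (simp add: finite_bijections)
  have "(\<Sum>c\<in>C. f r c * permanent_on (R - {r}) (C - {c}) f)
      = (\<Sum>(c, \<tau>)\<in>(SIGMA c:C. bijections (R - {r}) (C - {c})). f r c * (\<Prod>i\<in>R - {r}. f i (\<tau> i)))"
    using assms fin by (simp add: permanent_on_def sum_distrib_left sum.Sigma)
  also have "\<dots> = permanent_on R C f"
    unfolding permanent_on_def
  proof (rule sum.reindex_bij_witness[of _ "\<lambda>\<sigma>. (\<sigma> r, restrict \<sigma> (R - {r}))" "\<lambda>(c, \<tau>). \<tau>(r := c)"], goal_cases)
    case (1 x)
    then show ?case
      by (auto simp: bijections_def PiE_def extensional_def fun_eq_iff)
  next
    case (2 x)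
    obtain c \<tau> where x: "x = (c, \<tau>)" by force
    then have c: "c \<in> C" and \<tau>: "\<tau> \<in> (R - {r}) \<rightarrow>\<^sub>E (C - {c})" "bij_betw \<tau> (R - {r}) (C - {c})"
      using 2 by (auto simp: bijections_def)
    have "bij_betw (\<tau>(r := c)) (R - {r}) (C - {c})"
      using \<tau>(2) by (rule bij_betw_cong[THEN iffD1, rotated]) simp
    moreover have "bij_betw (\<tau>(r := c)) {r} {c}" by (simp add: bij_betw_def)
    ultimately have "bij_betw (\<tau>(r := c)) ({r} \<union> (R - {r})) ({c} \<union> (C - {c}))"
      by (intro bij_betw_combine) auto
    then have "bij_betw (\<tau>(r := c)) R C"
      using c assms(3) by (simp add: insert_absorb)
    then show ?case
      using x c \<tau> assms(3) by (auto simp: bijections_def PiE_def extensional_def)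
  next
    case (3 \<sigma>)
    then show ?case by (auto simp: bijections_def PiE_def extensional_def fun_eq_iff)
  next
    case (4 \<sigma>)
    then have \<sigma>: "\<sigma> \<in> R \<rightarrow>\<^sub>E C" "bij_betw \<sigma> R C" by (auto simp: bijections_def)
    have "bij_betw \<sigma> (R - {r}) (C - {\<sigma> r})"
      using \<sigma>(2) assms(3) by (intro bij_betw_DiffI) (auto simp: bij_betw_def)
    then show ?case
      using \<sigma> assms(3) by (auto intro: restrict_mem_bijections)
  next
    case (5 x)
    obtain c \<tau> where x: "x = (c, \<tau>)" by force
    have "(\<Prod>i\<in>R. f i ((\<tau>(r := c)) i)) = f r c * (\<Prod>i\<in>R - {r}. f i (\<tau> i))"
      using assms by (subst prod.remove[of R r]) auto
    then show ?case by (simp add: x)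
  qed
  finally show ?thesis ..
qed

lemma permanent_on_expand_column:
  assumes "finite R" "finite C" "c \<in> C"
  shows "permanent_on R C f = (\<Sum>r\<in>R. f r c * permanent_on (R - {r}) (C - {c}) f)"
proof -
  have "permanent_on R C f = permanent_on C R (\<lambda>j i. f i j)"
    by (rule permanent_on_transpose)
  also have "\<dots> = (\<Sum>r\<in>R. f r c * permanent_on (C - {c}) (R - {r}) (\<lambda>j i. f i j))"
    using assms permanent_on_expand_row[of C R c "\<lambda>j i. f i j"] by simp
  also have "\<dots> = (\<Sum>r\<in>R. f r c * permanent_on (R - {r}) (C - {c}) f)"
    by (subst permanent_on_transpose) simp
  finally show ?thesis .
qed

lemma acute_refl: "x \<noteq> 0 \<Longrightarrow> acute x x"
  by (simp add: acute_def)

text \<open>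
Two minors with the same columns whose row sets are \<open>R - {r}\<close> and \<open>R - {s}\<close> have all
rows but one in common. Expanding the first along row \<open>s\<close> and the second along row \<open>r\<close>
writes both as combinations of the \<^emph>\<open>same\<close> smaller minors, which differ from each other only in
the removed column. Rows and columns thus alternate, and both statements are proved
by one induction on the size.
\<close>
lemma acute_minors:
  fixes f :: "'a \<Rightarrow> 'b \<Rightarrow> complex"
  shows acute_row_minors:
    "\<And>R C r s. finite R \<Longrightarrow> finite C \<Longrightarrow> card R = Suc k \<Longrightarrow> card C = k \<Longrightarrow> r \<in> R \<Longrightarrow> s \<in> R \<Longrightarrow>
       (\<And>i j. i \<in> R \<Longrightarrow> j \<in> C \<Longrightarrow> cmod (1 - f i j) \<le> 1/2) \<Longrightarrow>
       acute (permanent_on (R - {r}) C f) (permanent_on (R - {s}) C f)"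
    and acute_column_minors:
    "\<And>R C c d. finite R \<Longrightarrow> finite C \<Longrightarrow> card R = k \<Longrightarrow> card C = Suc k \<Longrightarrow> c \<in> C \<Longrightarrow> d \<in> C \<Longrightarrow>
       (\<And>i j. i \<in> R \<Longrightarrow> j \<in> C \<Longrightarrow> cmod (1 - f i j) \<le> 1/2) \<Longrightarrow>
       acute (permanent_on R (C - {c}) f) (permanent_on R (C - {d}) f)"
proof (induction k)
  case 0
  case 1
  then show ?case by (auto simp: card_Suc_eq acute_def)
next
  case 0
  case 2
  then show ?case by (auto simp: card_Suc_eq acute_def)
next
  case (Suc k)
  case 1
  have *: "acute (permanent_on (R - {r}) C f) (permanent_on (R - {s}) C f)"
    if "r \<noteq> s" "r \<in> R" "s \<in> R" for r s
  proof -
    have eq: "R - {r} - {s} = R - {r, s}" "R - {s} - {r} = R - {r, s}" by auto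
    have "permanent_on (R - {r}) C f = (\<Sum>c\<in>C. f s c * permanent_on (R - {r, s}) (C - {c}) f)"
      using 1 that by (subst permanent_on_expand_row[where r = s]) (auto simp: eq)
    moreover have "permanent_on (R - {s}) C f = (\<Sum>c\<in>C. f r c * permanent_on (R - {r, s}) (C - {c}) f)"
      using 1 that by (subst permanent_on_expand_row[where r = r]) (auto simp: eq)
    moreover have "acute (\<Sum>c\<in>C. f s c * permanent_on (R - {r, s}) (C - {c}) f)
      (\<Sum>c\<in>C. f r c * permanent_on (R - {r, s}) (C - {c}) f)"
    proof (rule acute_combination)
      have "card (R - {r, s}) = k"
        using 1 that by (simp add: card_Diff_subset)
      then show "acute (permanent_on (R - {r, s}) (C - {c}) f) (permanent_on (R - {r, s}) (C - {d}) f)"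
        if "c \<in> C" "d \<in> C" for c d
        using 1 that by (intro Suc.IH) auto
    qed (use 1 that in auto)
    ultimately show ?thesis by simp
  qed
  show ?case
  proof (cases "r = s")
    case True
    \<comment> \<open>A number is acute to itself iff it is nonzero; any second row \<open>t\<close> shows this.\<close>
    have "\<not> R \<subseteq> {r}"
      using 1(3) card_mono[of "{r}" R] by auto
    then obtain t where "t \<in> R" "t \<noteq> r" by blast
    then have "permanent_on (R - {r}) C f \<noteq> 0"
      using *[of r t] 1 by (auto simp: acute_def)
    then show ?thesis using True by (simp add: acute_refl)
  qed (use * 1 in auto)
next
  case (Suc k)
  case 2
  have *: "acute (permanent_on R (C - {c}) f) (permanent_on R (C - {d}) f)"
    if "c \<noteq> d" "c \<in> C" "d \<in> C" for c d
  proof -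
    have eq: "C - {c} - {d} = C - {c, d}" "C - {d} - {c} = C - {c, d}" by auto
    have "permanent_on R (C - {c}) f = (\<Sum>r\<in>R. f r d * permanent_on (R - {r}) (C - {c, d}) f)"
      using 2 that by (subst permanent_on_expand_column[where c = d]) (auto simp: eq)
    moreover have "permanent_on R (C - {d}) f = (\<Sum>r\<in>R. f r c * permanent_on (R - {r}) (C - {c, d}) f)"
      using 2 that by (subst permanent_on_expand_column[where c = c]) (auto simp: eq)
    moreover have "acute (\<Sum>r\<in>R. f r d * permanent_on (R - {r}) (C - {c, d}) f)
      (\<Sum>r\<in>R. f r c * permanent_on (R - {r}) (C - {c, d}) f)"
    proof (rule acute_combination)
      have "card (C - {c, d}) = k"
        using 2 that by (simp add: card_Diff_subset)
      then show "acute (permanent_on (R - {r}) (C - {c, d}) f) (permanent_on (R - {s}) (C - {c, d}) f)"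
        if "r \<in> R" "s \<in> R" for r s
        using 2 that by (intro Suc.IH) auto
    qed (use 2 that in auto)
    ultimately show ?thesis by simp
  qed
  show ?case
  proof (cases "c = d")
    case True
    have "\<not> C \<subseteq> {c}"
      using 2(4) card_mono[of "{c}" C] by auto
    then obtain t where "t \<in> C" "t \<noteq> c" by blast
    then have "permanent_on R (C - {c}) f \<noteq> 0"
      using *[of c t] 2 by (auto simp: acute_def)
    then show ?thesis using True by (simp add: acute_refl)
  qed (use * 2 in auto)
qed

lemma permanent_eq_permanent_on:
  assumes "A \<in> carrier_mat n n"
  shows "permanent A = permanent_on {0..<n} {0..<n} (\<lambda>i j. A $$ (i, j))"
proof -
  have "permanent A = (\<Sum>\<sigma> | \<sigma> permutes {0..<n}. \<Prod>i = 0..<n. A $$ (i, \<sigma> i))"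
    using assms by (simp add: permanent_def)
  also have "\<dots> = permanent_on {0..<n} {0..<n} (\<lambda>i j. A $$ (i, j))"
    unfolding permanent_on_def
  proof (rule sum.reindex_bij_witness[of _ "\<lambda>\<tau> i. if i \<in> {0..<n} then \<tau> i else i" "\<lambda>\<sigma>. restrict \<sigma> {0..<n}"], goal_cases)
    case (1 \<sigma>)
    then show ?case by (auto simp: fun_eq_iff permutes_def)
  next
    case (2 \<sigma>)
    then have "bij_betw \<sigma> {0..<n} {0..<n}" by (simp add: permutes_imp_bij)
    then show ?case by (rule restrict_mem_bijections)
  next
    case (3 \<tau>)
    then show ?case by (auto simp: bijections_def fun_eq_iff extensional_def PiE_def)
  next
    case (4 \<tau>)
    then have "bij_betw \<tau> {0..<n} {0..<n}" by (simp add: bijections_def)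
    then have "bij_betw (\<lambda>i. if i \<in> {0..<n} then \<tau> i else i) {0..<n} {0..<n}"
      by (rule bij_betw_cong[THEN iffD1, rotated]) simp
    then show ?case by (auto intro!: bij_imp_permutes)
  qed (auto intro!: prod.cong)
  finally show ?thesis .
qed

text \<open>
Both permanents are combinations of the minors along the changed row; the minors coincide and
are pairwise acute.
\<close>
lemma acute_permanent_row_change:
  assumes A: "A \<in> matrix_polydisc n (1/2)" and B: "B \<in> matrix_polydisc n (1/2)" and r: "r < n"
    and same: "\<And>i j. i < n \<Longrightarrow> j < n \<Longrightarrow> i \<noteq> r \<Longrightarrow> A $$ (i, j) = B $$ (i, j)"
  shows "acute (permanent A) (permanent B)"
proof -
  define R where "R = {0..<n} - {r}"
  define minor where "minor c = permanent_on R ({0..<n} - {c}) (\<lambda>i j. A $$ (i, j))" for c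
  have AB: "A \<in> carrier_mat n n" "B \<in> carrier_mat n n"
    using A B by (auto simp: matrix_polydisc_def)
  have minor_B: "permanent_on R ({0..<n} - {c}) (\<lambda>i j. B $$ (i, j)) = minor c" for c
    unfolding minor_def using same by (intro permanent_on_cong) (auto simp: R_def)
  have "permanent A = (\<Sum>c\<in>{0..<n}. A $$ (r, c) * minor c)"
    unfolding permanent_eq_permanent_on[OF AB(1)] minor_def R_def
    using r by (intro permanent_on_expand_row) auto
  moreover have "permanent B = (\<Sum>c\<in>{0..<n}. B $$ (r, c) * minor c)"
    unfolding permanent_eq_permanent_on[OF AB(2)] minor_B[symmetric] R_def
    using r by (intro permanent_on_expand_row) auto
  moreover have "acute (\<Sum>c\<in>{0..<n}. A $$ (r, c) * minor c) (\<Sum>c\<in>{0..<n}. B $$ (r, c) * minor c)"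
  proof (rule acute_combination)
    show "acute (minor c) (minor d)" if "c \<in> {0..<n}" "d \<in> {0..<n}" for c d
      unfolding minor_def using A r that
      by (intro acute_column_minors[where k = "n - 1"]) (auto simp: R_def matrix_polydisc_def)
  qed (use A B r in \<open>auto simp: matrix_polydisc_def\<close>)
  ultimately show ?thesis by simp
qed

section \<open>The branch of the logarithm of the permanent\<close>

lemma permanent_mat:
  "permanent (mat n n h) = (\<Sum>\<sigma> | \<sigma> permutes {0..<n}. \<Prod>i = 0..<n. h (i, \<sigma> i))"
proof -
  have "\<sigma> i < n" if "\<sigma> permutes {0..<n}" "i < n" for \<sigma> i
    using permutes_in_image[OF that(1), of i] that(2) by simp
  then show ?thesis
    by (auto simp: permanent_def intro!: sum.cong prod.cong)
qed

lemma permanent_ones: "permanent (mat n n (\<lambda>_. 1)) = fact n"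
  by (simp add: permanent_mat card_permutations[of _ n])

lemma continuous_on_permanent:
  fixes h :: "'a::topological_space \<Rightarrow> nat \<times> nat \<Rightarrow> complex"
  assumes "\<And>i j. i < n \<Longrightarrow> j < n \<Longrightarrow> continuous_on S (\<lambda>x. h x (i, j))"
  shows "continuous_on S (\<lambda>x. permanent (mat n n (h x)))"
  unfolding permanent_mat
proof (intro continuous_on_sum continuous_on_prod)
  fix \<sigma> i assume "\<sigma> \<in> {\<sigma>. \<sigma> permutes {0..<n}}" "i \<in> {0..<n}"
  then have "i < n" "\<sigma> i < n"
    using permutes_in_image[of \<sigma> "{0..<n}" i] by auto
  then show "continuous_on S (\<lambda>x. h x (i, \<sigma> i))" by (rule assms)
qed

lemma permanent_in_Reals:
  assumes "\<And>i j. i < n \<Longrightarrow> j < n \<Longrightarrow> h (i, j) \<in> \<real>"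
  shows "permanent (mat n n h) \<in> (\<real> :: complex set)"
  unfolding permanent_mat
proof (intro sum_in_Reals prod_in_Reals)
  fix \<sigma> i assume "\<sigma> \<in> {\<sigma>. \<sigma> permutes {0..<n}}" "i \<in> {0..<n}"
  then have "i < n" "\<sigma> i < n"
    using permutes_in_image[of \<sigma> "{0..<n}" i] by auto
  then show "h (i, \<sigma> i) \<in> \<real>" by (rule assms)
qed

text \<open>
Quotients of acute numbers stay off the branch cut of the principal logarithm.
\<close>
lemma acute_quotient:
  assumes "acute x y"
  shows "y / x \<notin> \<real>\<^sub>\<le>\<^sub>0"
proof
  assume *: "y / x \<in> \<real>\<^sub>\<le>\<^sub>0"
  have "0 \<le> Re (y / x)"
    using assms by (simp add: acute_def complex_div_cnj[of y x] mult.commute)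
  then have "y / x = 0"
    using * by (auto simp: complex_nonpos_Reals_iff complex_eq_iff)
  then show False using assms by (simp add: acute_def)
qed

definition leading_rows :: "nat \<Rightarrow> nat \<Rightarrow> complex mat \<Rightarrow> complex mat" where
  "leading_rows n k Z = mat n n (\<lambda>(i, j). if i < k then Z $$ (i, j) else 1)"

text \<open>
An explicit branch of the logarithm of the permanent: turn the all-ones matrix into \<open>Z\<close> one
row at a time. Each step multiplies the permanent by a nonzero factor in the closed right half plane, so
its principal logarithm is continuous in \<open>Z\<close>.
\<close>
definition row_log_sum :: "nat \<Rightarrow> complex mat \<Rightarrow> complex" where
  "row_log_sum n Z = of_real (ln (fact n)) +
    (\<Sum>k<n. Ln (permanent (leading_rows n (Suc k) Z) / permanent (leading_rows n k Z)))"

lemma leading_rows_mem: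
  "Z \<in> matrix_polydisc n (1/2) \<Longrightarrow> leading_rows n k Z \<in> matrix_polydisc n (1/2)"
  by (auto simp: matrix_polydisc_def leading_rows_def)

lemma leading_rows_0: "leading_rows n 0 Z = mat n n (\<lambda>_. 1)"
  by (auto simp: leading_rows_def)

lemma leading_rows_all: "Z \<in> carrier_mat n n \<Longrightarrow> leading_rows n n Z = Z"
  by (auto simp: leading_rows_def)

lemma acute_leading_rows:
  assumes "Z \<in> matrix_polydisc n (1/2)" "k < n"
  shows "acute (permanent (leading_rows n k Z)) (permanent (leading_rows n (Suc k) Z))"
  by (rule acute_permanent_row_change[OF leading_rows_mem leading_rows_mem assms(2)])
     (use assms in \<open>auto simp: leading_rows_def\<close>)

lemma exp_row_log_sum:
  assumes Z: "Z \<in> matrix_polydisc n (1/2)"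
  shows "exp (row_log_sum n Z) = permanent Z"
proof -
  let ?p = "\<lambda>k. permanent (leading_rows n k Z)"
  have "Z \<in> carrier_mat n n" using Z by (simp add: matrix_polydisc_def)
  then have ends: "?p 0 = fact n" "?p n = permanent Z"
    by (simp_all add: leading_rows_0 leading_rows_all permanent_ones)
  have nz: "?p k \<noteq> 0" if "k \<le> n" for k
    using acute_leading_rows[OF Z, of k] acute_leading_rows[OF Z, of "k - 1"] that
    by (cases "k = n"; cases k) (auto simp: acute_def leading_rows_0 permanent_ones)
  have "(\<Prod>k<m. ?p (Suc k) / ?p k) = ?p m / ?p 0" if "m \<le> n" for m
    using that
  proof (induction m)
    case (Suc m)
    then show ?case using nz[of m] by simp
  qed (use nz[of 0] in simp)
  then have "(\<Prod>k<n. ?p (Suc k) / ?p k) = permanent Z / fact n"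
    by (simp add: ends)
  moreover have "exp (Ln (?p (Suc k) / ?p k)) = ?p (Suc k) / ?p k" if "k < n" for k
    using nz[of k] nz[of "Suc k"] that by (intro exp_Ln) auto
  moreover have "exp (of_real (ln (fact n :: real))) = (fact n :: complex)"
    by (simp add: exp_of_real)
  ultimately show ?thesis
    by (simp add: row_log_sum_def exp_add exp_sum)
qed

lemma permanent_nonzero: "Z \<in> matrix_polydisc n (1/2) \<Longrightarrow> permanent Z \<noteq> 0"
  by (metis exp_row_log_sum exp_not_eq_zero)

lemma is_ln_permanent_branch_row_log_sum: "is_ln_permanent_branch n (row_log_sum n)"
  unfolding is_ln_permanent_branch_def mat_continuous_on_def
proof (intro conjI ballI impI)
  let ?S = "{f :: nat \<times> nat \<Rightarrow> complex. mat n n f \<in> matrix_polydisc n (1/2)}"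
  have cont: "continuous_on ?S (\<lambda>f. permanent (leading_rows n k (mat n n f)))" for k
    unfolding leading_rows_def
  proof (rule continuous_on_permanent)
    fix i j assume "i < n" "j < n"
    moreover have "continuous_on ?S (\<lambda>f. f (i, j))"
      by (rule continuous_on_subset[OF continuous_on_product_coordinates]) simp
    ultimately show "continuous_on ?S (\<lambda>f. case (i, j) of (i, j) \<Rightarrow> if i < k then mat n n f $$ (i, j) else 1)"
      by (cases "i < k") simp_all
  qed
  show "continuous_on ?S (\<lambda>f. row_log_sum n (mat n n f))"
    unfolding row_log_sum_def
  proof (intro continuous_intros cont ballI)
    fix k f assume "k \<in> {..<n}" "f \<in> ?S"
    then have "acute (permanent (leading_rows n k (mat n n f))) (permanent (leading_rows n (Suc k) (mat n n f)))"
      by (intro acute_leading_rows) auto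
    then show "permanent (leading_rows n k (mat n n f)) \<noteq> 0"
      and "permanent (leading_rows n (Suc k) (mat n n f)) / permanent (leading_rows n k (mat n n f)) \<notin> \<real>\<^sub>\<le>\<^sub>0"
      by (simp add: acute_def, rule acute_quotient)
  qed
next
  fix Z assume Z: "Z \<in> matrix_polydisc n (1/2)" and real: "\<forall>i<n. \<forall>j<n. Z $$ (i, j) \<in> \<real>"
  have real_rows: "permanent (leading_rows n k Z) \<in> \<real>" for k
    unfolding leading_rows_def using real by (intro permanent_in_Reals) auto
  have "Ln (permanent (leading_rows n (Suc k) Z) / permanent (leading_rows n k Z)) \<in> \<real>" if "k < n" for k
  proof -
    let ?q = "permanent (leading_rows n (Suc k) Z) / permanent (leading_rows n k Z)"
    obtain x where x: "?q = of_real x"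
      using Reals_divide[OF real_rows real_rows] by (meson Reals_cases)
    have "?q \<notin> \<real>\<^sub>\<le>\<^sub>0"
      using acute_leading_rows[OF Z that] by (rule acute_quotient)
    then have "0 < x" by (auto simp: x complex_nonpos_Reals_iff)
    then show ?thesis by (simp add: x Ln_of_real)
  qed
  then show "row_log_sum n Z \<in> \<real>"
    unfolding row_log_sum_def by (intro Reals_add sum_in_Reals) auto
qed (rule exp_row_log_sum)

text \<open>
The difference of two continuous logarithms of the same function only takes values in
\<open>2 * pi * \<i> * \<int>\<close> and is therefore constant on an interval.
\<close>
lemma continuous_logs_agree:
  fixes f g :: "real \<Rightarrow> complex"
  assumes "continuous_on {0..1} f" "continuous_on {0..1} g"
    and exp_eq: "\<And>t. t \<in> {0..1} \<Longrightarrow> exp (f t) = exp (g t)" and "f 0 = g 0"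
  shows "f 1 = g 1"
proof -
  have "(\<lambda>t. f t - g t) constant_on {0..1}"
  proof (rule continuous_discrete_range_constant)
    show "continuous_on {0..1} (\<lambda>t. f t - g t)"
      using assms by (intro continuous_intros)
    fix s :: real assume s: "s \<in> {0..1}"
    have "2 * pi \<le> cmod ((f t - g t) - (f s - g s))"
      if t: "t \<in> {0..1}" and ne: "f t - g t \<noteq> f s - g s" for t
    proof (rule ccontr)
      assume "\<not> ?thesis"
      then have "\<bar>Im (f t - g t) - Im (f s - g s)\<bar> < 2 * pi"
        using abs_Im_le_cmod[of "(f t - g t) - (f s - g s)"] by simp
      moreover have "exp (f t - g t) = exp (f s - g s)"
        using exp_eq[OF t] exp_eq[OF s] by (simp add: exp_diff)
      ultimately have "f t - g t = f s - g s" by (rule exp_complex_eqI)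
      with ne show False by simp
    qed
    then show "\<exists>e>0. \<forall>t. t \<in> {0..1} \<and> f t - g t \<noteq> f s - g s \<longrightarrow> e \<le> cmod ((f t - g t) - (f s - g s))"
      by (intro exI[of _ "2 * pi"] conjI allI impI) (simp, blast)
  qed simp
  then have "f 1 - g 1 = f 0 - g 0"
    unfolding constant_on_def by (metis atLeastAtMost_iff order_refl zero_le_one)
  with assms(4) show ?thesis by simp
qed

text \<open>
The entries of \<open>J + t (A - J)\<close> with \<open>J\<close> the all-ones matrix. The parameter is complex: real
\<open>t\<close> between \<open>0\<close> and \<open>1\<close> give the path that pins down the branch, and complex \<open>t\<close> beyond the
unit disc give room for the Taylor expansion at \<open>t = 0\<close>.
\<close>
definition segment_to :: "complex mat \<Rightarrow> complex \<Rightarrow> nat \<times> nat \<Rightarrow> complex" where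
  "segment_to A t ij = 1 + t * (A $$ ij - 1)"

lemma segment_to_mem:
  assumes "A \<in> matrix_polydisc n r" "cmod t * r \<le> s"
  shows "mat n n (segment_to A t) \<in> matrix_polydisc n s"
proof -
  have "cmod (t * (A $$ (i, j) - 1)) \<le> s" if "i < n" "j < n" for i j
  proof -
    have "cmod (A $$ (i, j) - 1) \<le> r"
      using assms(1) that by (auto simp: matrix_polydisc_def norm_minus_commute)
    then have "cmod t * cmod (A $$ (i, j) - 1) \<le> cmod t * r"
      by (simp add: mult_left_mono)
    then show ?thesis using assms(2) by (simp add: norm_mult)
  qed
  then show ?thesis by (auto simp: matrix_polydisc_def segment_to_def norm_minus_commute)
qed

lemma segment_to_0: "mat n n (segment_to A 0) = mat n n (\<lambda>_. 1)"
  by (auto simp: segment_to_def)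

lemma segment_to_1: "A \<in> carrier_mat n n \<Longrightarrow> mat n n (segment_to A 1) = A"
  by (auto simp: segment_to_def)

lemma branch_continuous_on_segment:
  assumes L: "is_ln_permanent_branch n L" and A: "A \<in> matrix_polydisc n (1/2)"
  shows "continuous_on {0..1::real} (\<lambda>t. L (mat n n (segment_to A (of_real t))))"
proof (rule continuous_on_compose2[where f = "\<lambda>t. segment_to A (of_real t)" and g = "\<lambda>f. L (mat n n f)"])
  show "continuous_on {f. mat n n f \<in> matrix_polydisc n (1/2)} (\<lambda>f. L (mat n n f))"
    using L by (simp add: is_ln_permanent_branch_def mat_continuous_on_def)
  show "continuous_on {0..1::real} (\<lambda>t. segment_to A (of_real t))"
    unfolding segment_to_def
    by (intro continuous_on_coordinatewise_then_product continuous_intros)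
  show "(\<lambda>t. segment_to A (of_real t)) ` {0..1} \<subseteq> {f. mat n n f \<in> matrix_polydisc n (1/2)}"
    using A by (auto intro!: segment_to_mem)
qed

text \<open>
The value at \<open>J\<close> is real by the definition of the branch, and the exponential function is injective on the reals.
\<close>
lemma branch_at_ones:
  assumes "is_ln_permanent_branch n L"
  shows "L (mat n n (\<lambda>_. 1)) = of_real (ln (fact n))"
proof -
  let ?J = "mat n n (\<lambda>_. 1 :: complex)"
  have J: "?J \<in> matrix_polydisc n (1/2)" by (auto simp: matrix_polydisc_def)
  then have "L ?J \<in> \<real>" "exp (L ?J) = fact n"
    using assms by (auto simp: is_ln_permanent_branch_def permanent_ones)
  moreover then obtain x where x: "L ?J = of_real x" by (auto elim: Reals_cases)
  ultimately have "exp x = fact n"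
    by (metis exp_of_real of_real_eq_iff of_real_fact)
  then have "x = ln (fact n)" by (metis ln_exp)
  then show ?thesis by (simp add: x)
qed

text \<open>
Both uniqueness of the branch and its computation through the roots of a polynomial are
instances of this: any continuous logarithm along the segment from \<open>J\<close> to \<open>A\<close> that starts
at the right value computes the branch.
\<close>
lemma branch_determined_by_path:
  assumes L: "is_ln_permanent_branch n L" and A: "A \<in> matrix_polydisc n (1/2)"
    and "continuous_on {0..1} h" "h 0 = of_real (ln (fact n))"
    and h: "\<And>t. t \<in> {0..1} \<Longrightarrow> exp (h t) = permanent (mat n n (segment_to A (of_real t)))"
  shows "L A = h 1"
proof -
  have "L (mat n n (segment_to A (of_real 1))) = h 1"
  proof (rule continuous_logs_agree[where f = "\<lambda>t. L (mat n n (segment_to A (of_real t)))"])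
    fix t :: real assume t: "t \<in> {0..1}"
    then have "mat n n (segment_to A (of_real t)) \<in> matrix_polydisc n (1/2)"
      using A by (intro segment_to_mem) auto
    then show "exp (L (mat n n (segment_to A (of_real t)))) = exp (h t)"
      using L h[OF t] by (auto simp: is_ln_permanent_branch_def)
  next
    show "L (mat n n (segment_to A (of_real 0))) = h 0"
      using assms by (simp add: segment_to_0 branch_at_ones)
  qed (use assms in \<open>auto intro: branch_continuous_on_segment\<close>)
  then show ?thesis using A by (simp add: segment_to_1 matrix_polydisc_def)
qed

lemma is_ln_permanent_branch_cong:
  assumes "\<And>Z. Z \<in> matrix_polydisc n (1/2) \<Longrightarrow> L Z = M Z"
  shows "is_ln_permanent_branch n L \<longleftrightarrow> is_ln_permanent_branch n M"
proof -
  let ?S = "{f :: nat \<times> nat \<Rightarrow> complex. mat n n f \<in> matrix_polydisc n (1/2)}"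
  have "continuous_on ?S (\<lambda>f. L (mat n n f)) \<longleftrightarrow> continuous_on ?S (\<lambda>f. M (mat n n f))"
    by (rule continuous_on_cong[OF refl]) (simp add: assms)
  moreover have "(\<forall>Z \<in> matrix_polydisc n (1/2). exp (L Z) = permanent Z) \<longleftrightarrow>
      (\<forall>Z \<in> matrix_polydisc n (1/2). exp (M Z) = permanent Z)"
    by (rule ball_cong[OF refl]) (simp add: assms)
  moreover have "(\<forall>Z \<in> matrix_polydisc n (1/2). (\<forall>i<n. \<forall>j<n. Z $$ (i, j) \<in> \<real>) \<longrightarrow> L Z \<in> \<real>) \<longleftrightarrow>
      (\<forall>Z \<in> matrix_polydisc n (1/2). (\<forall>i<n. \<forall>j<n. Z $$ (i, j) \<in> \<real>) \<longrightarrow> M Z \<in> \<real>)"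
    by (rule ball_cong[OF refl]) (simp add: assms)
  ultimately show ?thesis
    unfolding is_ln_permanent_branch_def mat_continuous_on_def by (simp only:)
qed

lemma branches_agree:
  assumes L: "is_ln_permanent_branch n L" and M: "is_ln_permanent_branch n M"
    and A: "A \<in> matrix_polydisc n (1/2)"
  shows "L A = M A"
proof -
  let ?h = "\<lambda>t. M (mat n n (segment_to A (of_real t)))"
  have "L A = ?h 1"
  proof (rule branch_determined_by_path[OF L A])
    show "continuous_on {0..1} ?h" using M A by (rule branch_continuous_on_segment)
    show "?h 0 = of_real (ln (fact n))" using M by (simp add: segment_to_0 branch_at_ones)
    fix t :: real assume "t \<in> {0..1}"
    then have "mat n n (segment_to A (of_real t)) \<in> matrix_polydisc n (1/2)"
      using A by (intro segment_to_mem) auto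
    then show "exp (?h t) = permanent (mat n n (segment_to A (of_real t)))"
      using M by (auto simp: is_ln_permanent_branch_def)
  qed
  then show ?thesis using A by (simp add: segment_to_1 matrix_polydisc_def)
qed

lemma ln_permanent_eq_row_log_sum:
  assumes "A \<in> matrix_polydisc n (1/2)"
  shows "ln_permanent n A = row_log_sum n A"
proof -
  let ?D = "matrix_polydisc n (1/2)"
  let ?L = "restrict (row_log_sum n) ?D"
  have branch: "is_ln_permanent_branch n ?L"
    using is_ln_permanent_branch_row_log_sum
    by (rule is_ln_permanent_branch_cong[THEN iffD1, rotated]) simp
  have "ln_permanent n = ?L"
    unfolding ln_permanent_def
  proof (rule the_equality)
    fix M assume M: "M \<in> extensional ?D \<and> is_ln_permanent_branch n M"
    show "M = ?L"
      by (rule extensionalityI[of _ ?D]) (use M branch in \<open>auto intro: branches_agree simp del: restrict_apply\<close>)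
  qed (use branch in auto)
  then show ?thesis using assms by simp
qed

lemma is_ln_permanent_branch_ln_permanent: "is_ln_permanent_branch n (ln_permanent n)"
  using is_ln_permanent_branch_row_log_sum
  by (rule is_ln_permanent_branch_cong[THEN iffD1, rotated]) (simp add: ln_permanent_eq_row_log_sum)

section \<open>Polynomials in the entries of a matrix\<close>

definition entry_monom_eval :: "entry_monom \<Rightarrow> complex mat \<Rightarrow> complex" where
  "entry_monom_eval m A = (\<Prod>v \<in> Poly_Mapping.keys m. (A $$ v) ^ Poly_Mapping.lookup m v)"

text \<open>
It is easier to show that a function of the matrix is given by a polynomial than to exhibit
that polynomial, because functions of this kind are closed under the arithmetic operations.
\<close>
definition entry_polynomial :: "nat \<Rightarrow> nat \<Rightarrow> (complex mat \<Rightarrow> complex) \<Rightarrow> bool" where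
  "entry_polynomial n d F \<longleftrightarrow>
    (\<exists>p. entry_poly_vars p \<subseteq> {0..<n} \<times> {0..<n} \<and> entry_poly_degree p \<le> d \<and>
      (\<forall>A. entry_poly_eval p A = F A))"

lemma entry_poly_degree_le_iff:
  "entry_poly_degree p \<le> d \<longleftrightarrow> (\<forall>m \<in> Poly_Mapping.keys p. entry_monom_degree m \<le> d)"
  by (simp add: entry_poly_degree_def)

lemma entry_poly_vars_subset_iff:
  "entry_poly_vars p \<subseteq> V \<longleftrightarrow> (\<forall>m \<in> Poly_Mapping.keys p. Poly_Mapping.keys m \<subseteq> V)"
  by (auto simp: entry_poly_vars_def)

lemma entry_poly_eval_superset:
  assumes "finite S" "Poly_Mapping.keys p \<subseteq> S"
  shows "entry_poly_eval p A = (\<Sum>m\<in>S. Poly_Mapping.lookup p m * entry_monom_eval m A)"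
  unfolding entry_poly_eval_def entry_monom_eval_def using assms
  by (intro sum.mono_neutral_left) (auto simp: in_keys_iff)

lemma entry_monom_eval_superset:
  assumes "finite V" "Poly_Mapping.keys m \<subseteq> V"
  shows "entry_monom_eval m A = (\<Prod>v\<in>V. (A $$ v) ^ Poly_Mapping.lookup m v)"
  unfolding entry_monom_eval_def using assms
  by (intro prod.mono_neutral_left) (auto simp: in_keys_iff)

lemma entry_monom_degree_superset:
  assumes "finite V" "Poly_Mapping.keys m \<subseteq> V"
  shows "entry_monom_degree m = (\<Sum>v\<in>V. Poly_Mapping.lookup m v)"
  unfolding entry_monom_degree_def using assms
  by (intro sum.mono_neutral_left) (auto simp: in_keys_iff)

lemma entry_monom_eval_add:
  "entry_monom_eval (m + m') A = entry_monom_eval m A * entry_monom_eval m' A"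
proof -
  let ?V = "Poly_Mapping.keys m \<union> Poly_Mapping.keys m'"
  have "finite ?V" by simp
  moreover have "Poly_Mapping.keys (m + m') \<subseteq> ?V" by (rule Poly_Mapping.keys_add)
  ultimately show ?thesis
    by (simp add: entry_monom_eval_superset[of ?V] lookup_add power_add prod.distrib)
qed

lemma entry_monom_degree_add:
  "entry_monom_degree (m + m') = entry_monom_degree m + entry_monom_degree m'"
proof -
  let ?V = "Poly_Mapping.keys m \<union> Poly_Mapping.keys m'"
  have "finite ?V" by simp
  moreover have "Poly_Mapping.keys (m + m') \<subseteq> ?V" by (rule Poly_Mapping.keys_add)
  ultimately show ?thesis
    by (simp add: entry_monom_degree_superset[of ?V] lookup_add sum.distrib)
qed

lemma entry_polynomial_monom:
  assumes "Poly_Mapping.keys m \<subseteq> {0..<n} \<times> {0..<n}" "entry_monom_degree m \<le> d"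
  shows "entry_polynomial n d (\<lambda>A. c * entry_monom_eval m A)"
  unfolding entry_polynomial_def
proof (intro exI[of _ "Poly_Mapping.single m c"] conjI allI)
  show "entry_poly_eval (Poly_Mapping.single m c) A = c * entry_monom_eval m A" for A
    by (subst entry_poly_eval_superset[of "{m}"]) auto
qed (use assms in \<open>auto simp: entry_poly_degree_le_iff entry_poly_vars_subset_iff\<close>)

lemma entry_polynomial_const: "entry_polynomial n d (\<lambda>_. c)"
  using entry_polynomial_monom[of 0 n d c] by (simp add: entry_monom_eval_def entry_monom_degree_def)

lemma entry_polynomial_entry:
  assumes "i < n" "j < n"
  shows "entry_polynomial n 1 (\<lambda>A. A $$ (i, j))"
  using entry_polynomial_monom[of "Poly_Mapping.single (i, j) 1" n 1 1] assms
  by (simp add: entry_monom_eval_def entry_monom_degree_def)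

lemma entry_polynomial_mono:
  "entry_polynomial n d F \<Longrightarrow> d \<le> e \<Longrightarrow> entry_polynomial n e F"
  unfolding entry_polynomial_def by (meson order_trans)

lemma entry_polynomial_add:
  assumes "entry_polynomial n d F" "entry_polynomial n d G"
  shows "entry_polynomial n d (\<lambda>A. F A + G A)"
proof -
  obtain p where p: "entry_poly_vars p \<subseteq> {0..<n} \<times> {0..<n}" "entry_poly_degree p \<le> d"
      "\<And>A. entry_poly_eval p A = F A"
    using assms(1) unfolding entry_polynomial_def by blast
  obtain q where q: "entry_poly_vars q \<subseteq> {0..<n} \<times> {0..<n}" "entry_poly_degree q \<le> d"
      "\<And>A. entry_poly_eval q A = G A"
    using assms(2) unfolding entry_polynomial_def by blast
  let ?S = "Poly_Mapping.keys p \<union> Poly_Mapping.keys q"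
  have keys: "Poly_Mapping.keys (p + q) \<subseteq> ?S" by (rule Poly_Mapping.keys_add)
  have "entry_poly_eval (p + q) A = F A + G A" for A
    using keys unfolding p(3)[symmetric] q(3)[symmetric]
    by (simp add: entry_poly_eval_superset[of ?S] lookup_add distrib_right sum.distrib)
  moreover have "entry_poly_vars (p + q) \<subseteq> {0..<n} \<times> {0..<n}"
    using p(1) q(1) keys unfolding entry_poly_vars_subset_iff by blast
  moreover have "entry_poly_degree (p + q) \<le> d"
    using p(2) q(2) keys unfolding entry_poly_degree_le_iff by blast
  ultimately show ?thesis unfolding entry_polynomial_def by blast
qed

lemma entry_polynomial_sum:
  "(\<And>x. x \<in> S \<Longrightarrow> entry_polynomial n d (F x)) \<Longrightarrow> entry_polynomial n d (\<lambda>A. \<Sum>x\<in>S. F x A)"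
  by (induction S rule: infinite_finite_induct)
     (simp_all add: entry_polynomial_const entry_polynomial_add)

text \<open>
By distributivity the product of two polynomials is a sum of scaled monomials, each of which
has a degree at most \<open>d + e\<close>; sums of polynomials are already covered.
\<close>
lemma entry_polynomial_mult:
  assumes "entry_polynomial n d F" "entry_polynomial n e G"
  shows "entry_polynomial n (d + e) (\<lambda>A. F A * G A)"
proof -
  obtain p where p: "entry_poly_vars p \<subseteq> {0..<n} \<times> {0..<n}" "entry_poly_degree p \<le> d"
      "\<And>A. entry_poly_eval p A = F A"
    using assms(1) unfolding entry_polynomial_def by blast
  obtain q where q: "entry_poly_vars q \<subseteq> {0..<n} \<times> {0..<n}" "entry_poly_degree q \<le> e"
      "\<And>A. entry_poly_eval q A = G A"
    using assms(2) unfolding entry_polynomial_def by blast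
  have "F A * G A = (\<Sum>m\<in>Poly_Mapping.keys p. \<Sum>m'\<in>Poly_Mapping.keys q.
      (Poly_Mapping.lookup p m * Poly_Mapping.lookup q m') * entry_monom_eval (m + m') A)" for A
    unfolding p(3)[symmetric] q(3)[symmetric]
    by (simp add: entry_poly_eval_superset[OF finite_keys subset_refl] sum_product
        entry_monom_eval_add mult_ac)
  moreover have "entry_polynomial n (d + e) (\<lambda>A. \<Sum>m\<in>Poly_Mapping.keys p. \<Sum>m'\<in>Poly_Mapping.keys q.
      (Poly_Mapping.lookup p m * Poly_Mapping.lookup q m') * entry_monom_eval (m + m') A)"
  proof (intro entry_polynomial_sum entry_polynomial_monom)
    fix m m' assume m: "m \<in> Poly_Mapping.keys p" "m' \<in> Poly_Mapping.keys q"
    show "Poly_Mapping.keys (m + m') \<subseteq> {0..<n} \<times> {0..<n}"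
      using Poly_Mapping.keys_add[of m m'] p(1) q(1) m unfolding entry_poly_vars_subset_iff by blast
    show "entry_monom_degree (m + m') \<le> d + e"
      using p(2) q(2) m unfolding entry_poly_degree_le_iff entry_monom_degree_add
      by (simp add: add_mono)
  qed
  ultimately show ?thesis by simp
qed

lemma entry_polynomial_cmult: "entry_polynomial n d F \<Longrightarrow> entry_polynomial n d (\<lambda>A. c * F A)"
  using entry_polynomial_mult[OF entry_polynomial_const[of n 0 c]] by simp

text \<open>
A coefficient of degree \<open>k\<close> picks the linear term in \<open>k\<close> of the factors, so it involves products
of \<open>k\<close> of the \<open>x i\<close> only.
\<close>
lemma entry_polynomial_coeff_prod_linear:
  assumes "finite I" and "\<And>i. i \<in> I \<Longrightarrow> entry_polynomial n 1 (x i)"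
  shows "entry_polynomial n k (\<lambda>A. coeff (\<Prod>i\<in>I. [:1, x i A:]) k)"
  using assms
proof (induction I arbitrary: k rule: finite_induct)
  case empty
  then show ?case by (simp add: entry_polynomial_const)
next
  case (insert i I)
  let ?c = "\<lambda>k A. coeff (\<Prod>i\<in>I. [:1, x i A:]) k"
  have c: "entry_polynomial n k (?c k)" for k using insert by simp
  show ?case
  proof (cases k)
    case 0
    then show ?thesis using c[of 0] insert(1,2) by simp
  next
    case (Suc l)
    have "entry_polynomial n (1 + l) (\<lambda>A. x i A * ?c l A)"
      using insert.prems c by (intro entry_polynomial_mult) auto
    then have "entry_polynomial n k (\<lambda>A. ?c k A + x i A * ?c l A)"
      using Suc c[of k] by (intro entry_polynomial_add) auto
    then show ?thesis using insert(1,2) Suc by simp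
  qed
qed

section \<open>Power sums and the logarithmic series\<close>

text \<open>
Logarithmic differentiation: \<open>w / (1 - w X)\<close> is the generating function of \<open>w ^ Suc k\<close>.
\<close>
lemma fps_deriv_prod_linear:
  fixes w :: "'i \<Rightarrow> 'a::field_char_0"
  assumes "finite I"
  shows "fps_deriv (\<Prod>i\<in>I. 1 - fps_const (w i) * fps_X)
    = - (\<Prod>i\<in>I. 1 - fps_const (w i) * fps_X) * Abs_fps (\<lambda>k. \<Sum>i\<in>I. w i ^ Suc k)"
  using assms
proof (induction I rule: finite_induct)
  case empty
  have "Abs_fps (\<lambda>k. 0) = (0 :: 'a fps)" by (simp add: fps_eq_iff)
  then show ?case by simp
next
  case (insert i I)
  let ?P = "\<Prod>i\<in>I. 1 - fps_const (w i) * fps_X"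
  let ?S = "Abs_fps (\<lambda>k. \<Sum>i\<in>I. w i ^ Suc k)"
  let ?l = "1 - fps_const (w i) * fps_X" and ?G = "Abs_fps (\<lambda>k. w i ^ Suc k)"
  have G: "?l * ?G = fps_const (w i)"
  proof (rule fps_ext)
    show "fps_nth (?l * ?G) k = fps_nth (fps_const (w i)) k" for k
      by (cases k) (simp_all add: left_diff_distrib mult.assoc)
  qed
  have ring: "l * (- P * S) - (l * G) * P = - (l * P) * (S + G)" for l P S G :: "'a fps"
    by (simp add: algebra_simps)
  have "fps_deriv (\<Prod>i\<in>insert i I. 1 - fps_const (w i) * fps_X)
      = ?l * fps_deriv ?P - fps_const (w i) * ?P"
    using insert.hyps by (simp add: algebra_simps)
  also have "\<dots> = ?l * (- ?P * ?S) - (?l * ?G) * ?P"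
    by (simp only: insert.IH G)
  also have "\<dots> = - (?l * ?P) * (?S + ?G)"
    by (rule ring)
  also have "?S + ?G = Abs_fps (\<lambda>k. \<Sum>i\<in>insert i I. w i ^ Suc k)"
    using insert.hyps by (intro fps_ext) (simp add: add.commute)
  also have "?l * ?P = (\<Prod>i\<in>insert i I. 1 - fps_const (w i) * fps_X)"
    using insert.hyps by simp
  finally show ?case .
qed

text \<open>
Newton's identities between the coefficients of a polynomial and the power sums of the
\<open>w i\<close>, its inverse roots.
\<close>
lemma newton_identity:
  fixes w :: "'i \<Rightarrow> 'a::field_char_0"
  assumes "finite I" and p: "p = Polynomial.smult c (\<Prod>i\<in>I. [:1, - w i:])"
  shows "of_nat (Suc k) * coeff p (Suc k)
    = - (\<Sum>j\<le>k. (\<Sum>i\<in>I. w i ^ Suc j) * coeff p (k - j))"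
proof -
  let ?S = "Abs_fps (\<lambda>k. \<Sum>i\<in>I. w i ^ Suc k)"
  have linear: "fps_of_poly [:1, - w i:] = 1 - fps_const (w i) * fps_X" for i
    by (simp add: fps_of_poly_linear)
  have P: "fps_of_poly p = fps_const c * (\<Prod>i\<in>I. 1 - fps_const (w i) * fps_X)"
    by (simp add: p fps_of_poly_smult fps_of_poly_prod linear)
  have "fps_deriv (fps_of_poly p) = - (?S * fps_of_poly p)"
    unfolding P using fps_deriv_prod_linear[OF assms(1), of w] by (simp add: mult_ac)
  then have "fps_nth (fps_deriv (fps_of_poly p)) k = fps_nth (- (?S * fps_of_poly p)) k" by simp
  then show ?thesis by (simp add: fps_mult_nth atLeast0AtMost)
qed

text \<open>
The product has \<open>n\<close> factors whatever the degree of \<open>p\<close> is: the missing roots lie at infinity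
and have inverse \<open>0\<close>. This uniform shape is what lets the roots of a family of polynomials
be summed over a fixed index set.
\<close>
lemma complex_poly_factor_inverse_roots:
  fixes p :: "complex poly"
  assumes "poly p 0 \<noteq> 0" "degree p \<le> n"
  shows "\<exists>w. p = Polynomial.smult (poly p 0) (\<Prod>i<n. [:1, - w i:])"
proof -
  obtain root where root: "Polynomial.smult (lead_coeff p) (\<Prod>i<degree p. [:- root i, 1:]) = p"
    by (rule complex_poly_decompose')
  define w where "w i = (if i < degree p then 1 / root i else 0)" for i
  have nz: "root i \<noteq> 0" if "i < degree p" for i
  proof
    assume "root i = 0"
    then have "poly (\<Prod>i<degree p. [:- root i, 1:]) 0 = 0"
      using that by (auto simp: poly_prod)
    then have "poly p 0 = 0" by (subst root[symmetric]) simp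
    with assms(1) show False ..
  qed
  have "[:- root i, 1:] = Polynomial.smult (- root i) [:1, - w i:]" if "i < degree p" for i
    using nz[OF that] that by (simp add: w_def)
  then have "(\<Prod>i<degree p. [:- root i, 1:]) = (\<Prod>i<degree p. Polynomial.smult (- root i) [:1, - w i:])"
    by (intro prod.cong) auto
  also have "\<dots> = Polynomial.smult (\<Prod>i<degree p. - root i) (\<Prod>i<degree p. [:1, - w i:])"
    by (rule prod_smult)
  also have "(\<Prod>i<degree p. [:1, - w i:]) = (\<Prod>i<n. [:1, - w i:])"
    using assms(2) by (intro prod.mono_neutral_left) (auto simp: w_def one_pCons)
  finally have eq: "p = Polynomial.smult (lead_coeff p * (\<Prod>i<degree p. - root i)) (\<Prod>i<n. [:1, - w i:])"
    using root by simp
  then have "poly p 0 = poly (Polynomial.smult (lead_coeff p * (\<Prod>i<degree p. - root i)) (\<Prod>i<n. [:1, - w i:])) 0"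
    by simp
  also have "\<dots> = lead_coeff p * (\<Prod>i<degree p. - root i)"
    by (simp add: poly_prod)
  finally show ?thesis using eq by metis
qed

text \<open>
The tail of the series of \<open>Ln (1 - w)\<close> is dominated by a geometric series.
\<close>
lemma Ln_taylor_remainder:
  assumes "cmod w \<le> \<rho>" "\<rho> < 1"
  shows "cmod (Ln (1 - w) + (\<Sum>k<m. w ^ Suc k / of_nat (Suc k))) \<le> \<rho> ^ Suc m / (1 - \<rho>)"
proof -
  have \<rho>: "0 \<le> \<rho>" using assms(1) norm_ge_zero order_trans by blast
  let ?f = "\<lambda>k. - (w ^ k / of_nat k)"
  have "?f sums Ln (1 - w)"
    using Ln_series'[of "- w"] assms by simp
  then have "(\<lambda>k. ?f (k + Suc m)) sums (Ln (1 - w) - (\<Sum>k<Suc m. ?f k))"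
    by (rule sums_split_initial_segment)
  moreover have "(\<Sum>k<Suc m. ?f k) = - (\<Sum>k<m. w ^ Suc k / of_nat (Suc k))"
    by (subst sum.lessThan_Suc_shift) (simp add: sum_negf)
  ultimately have tail: "(\<lambda>k. ?f (k + Suc m)) sums (Ln (1 - w) + (\<Sum>k<m. w ^ Suc k / of_nat (Suc k)))"
    by simp
  have "(\<lambda>k. \<rho> ^ Suc m * \<rho> ^ k) sums (\<rho> ^ Suc m * (1 / (1 - \<rho>)))"
    using \<rho> assms(2) by (intro sums_mult geometric_sums) simp
  moreover have "cmod (?f (k + Suc m)) \<le> \<rho> ^ Suc m * \<rho> ^ k" for k
  proof -
    have "cmod (?f (k + Suc m)) = cmod w ^ (k + Suc m) / real (k + Suc m)"
      by (simp only: norm_minus_cancel norm_divide norm_power norm_of_nat)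
    also have "\<dots> \<le> cmod w ^ (k + Suc m) / 1"
      by (intro divide_left_mono) auto
    also have "\<dots> \<le> \<rho> ^ (k + Suc m)"
      using assms(1) by (simp add: power_mono del: power_Suc add_Suc_right)
    finally show ?thesis by (simp only: power_add mult.commute)
  qed
  ultimately have "cmod (Ln (1 - w) + (\<Sum>k<m. w ^ Suc k / of_nat (Suc k))) \<le> \<rho> ^ Suc m * (1 / (1 - \<rho>))"
    using norm_sums_le[OF tail] by blast
  then show ?thesis by simp
qed

section \<open>Polynomial approximation of the logarithm\<close>

text \<open>
The permanent of \<open>J + t (A - J)\<close> as a polynomial in \<open>t\<close>.
\<close>
definition segment_poly :: "nat \<Rightarrow> complex mat \<Rightarrow> complex poly" where
  "segment_poly n A = (\<Sum>\<sigma> | \<sigma> permutes {0..<n}. \<Prod>i = 0..<n. [:1, A $$ (i, \<sigma> i) - 1:])"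

lemma poly_segment_poly: "poly (segment_poly n A) t = permanent (mat n n (segment_to A t))"
  by (simp add: segment_poly_def permanent_mat segment_to_def poly_sum poly_prod)

lemma poly_segment_poly_0: "poly (segment_poly n A) 0 = fact n"
  by (simp add: poly_segment_poly segment_to_0 permanent_ones)

lemma degree_segment_poly: "degree (segment_poly n A) \<le> n"
  unfolding segment_poly_def
proof (rule degree_sum_le)
  show "finite {\<sigma>. \<sigma> permutes {0..<n}}" by (simp add: finite_permutations)
  fix \<sigma> assume "\<sigma> \<in> {\<sigma>. \<sigma> permutes {0..<n}}"
  have "degree (\<Prod>i = 0..<n. [:1, A $$ (i, \<sigma> i) - 1:]) \<le> (\<Sum>i = 0..<n. degree [:1, A $$ (i, \<sigma> i) - 1:])"
    by (rule degree_prod_sum_le[unfolded o_def]) simp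
  also have "\<dots> \<le> (\<Sum>i = 0..<n. 1)"
    by (intro sum_mono) (simp add: degree_pCons_eq_if)
  finally show "degree (\<Prod>i = 0..<n. [:1, A $$ (i, \<sigma> i) - 1:]) \<le> n" by simp
qed

lemma entry_polynomial_coeff_segment_poly:
  "entry_polynomial n k (\<lambda>A. coeff (segment_poly n A) k)"
  unfolding segment_poly_def coeff_sum
proof (intro entry_polynomial_sum entry_polynomial_coeff_prod_linear)
  fix \<sigma> i assume "\<sigma> \<in> {\<sigma>. \<sigma> permutes {0..<n}}" "i \<in> {0..<n}"
  then have "i < n" "\<sigma> i < n"
    using permutes_in_image[of \<sigma> "{0..<n}" i] by auto
  then show "entry_polynomial n 1 (\<lambda>A. A $$ (i, \<sigma> i) - 1)"
    using entry_polynomial_add[OF entry_polynomial_entry entry_polynomial_const[of n 1 "- 1"]] by simp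
qed simp

text \<open>
The inverse roots themselves are not polynomial in the entries of \<open>A\<close>, but their power sums
are: the constant coefficient of \<open>segment_poly n A\<close> is \<open>fact n\<close> for every \<open>A\<close>, so Newton's identities can
be solved for the power sums without dividing by anything that depends on \<open>A\<close>.
\<close>
lemma entry_polynomial_power_sum:
  assumes w: "\<And>A. segment_poly n A = Polynomial.smult (fact n) (\<Prod>i<n. [:1, - w A i:])"
  shows "entry_polynomial n (Suc k) (\<lambda>A. \<Sum>i<n. w A i ^ Suc k)"
proof (induction k rule: less_induct)
  case (less k)
  let ?g = "\<lambda>A. coeff (segment_poly n A)" and ?s = "\<lambda>j A. \<Sum>i<n. w A i ^ Suc j"
  have "?s k A = (- (of_nat (Suc k) / fact n)) * ?g A (Suc k)
      + (- (1 / fact n)) * (\<Sum>j<k. ?s j A * ?g A (k - j))" for A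
  proof -
    have "?g A 0 = fact n"
      using poly_segment_poly_0 by (simp add: poly_0_coeff_0)
    moreover have "of_nat (Suc k) * ?g A (Suc k) = - (\<Sum>j\<le>k. ?s j A * ?g A (k - j))"
      using w by (rule newton_identity[OF finite_lessThan])
    moreover have "(\<Sum>j\<le>k. ?s j A * ?g A (k - j)) = (\<Sum>j<k. ?s j A * ?g A (k - j)) + ?s k A * ?g A 0"
      by (simp add: lessThan_Suc_atMost[symmetric])
    ultimately have "?s k A * fact n = - (of_nat (Suc k) * ?g A (Suc k)) - (\<Sum>j<k. ?s j A * ?g A (k - j))"
      by simp
    then have "?s k A = (- (of_nat (Suc k) * ?g A (Suc k)) - (\<Sum>j<k. ?s j A * ?g A (k - j))) / fact n"
      by (simp only: eq_divide_eq) simp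
    then show ?thesis by (simp add: diff_divide_distrib)
  qed
  moreover have "entry_polynomial n (Suc k) (\<lambda>A. (- (of_nat (Suc k) / fact n)) * ?g A (Suc k)
      + (- (1 / fact n)) * (\<Sum>j<k. ?s j A * ?g A (k - j)))"
  proof (intro entry_polynomial_add entry_polynomial_cmult entry_polynomial_sum
      entry_polynomial_coeff_segment_poly)
    fix j assume "j \<in> {..<k}"
    then show "entry_polynomial n (Suc k) (\<lambda>A. ?s j A * ?g A (k - j))"
      using entry_polynomial_mult[OF less.IH[of j] entry_polynomial_coeff_segment_poly[of n "k - j"]]
      by simp
  qed
  ultimately show ?case by simp
qed

text \<open>
A root \<open>1 / w i\<close> inside the disc of radius \<open>1 / \<rho>\<close> would give a matrix in the polydisc of
radius \<open>1/2\<close> with vanishing permanent.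
\<close>
lemma inverse_root_bound:
  assumes "0 < \<rho>" and A: "A \<in> matrix_polydisc n (\<rho> / 2)"
    and w: "segment_poly n A = Polynomial.smult (fact n) (\<Prod>i<n. [:1, - w i:])" and i: "i < n"
  shows "cmod (w i) \<le> \<rho>"
proof (rule ccontr)
  assume *: "\<not> cmod (w i) \<le> \<rho>"
  then have nz: "w i \<noteq> 0" using assms(1) by auto
  have "poly (segment_poly n A) (1 / w i) = 0"
    using i nz by (auto simp: w poly_prod)
  moreover have "mat n n (segment_to A (1 / w i)) \<in> matrix_polydisc n (1/2)"
    using * assms(1) by (intro segment_to_mem[OF A]) (simp add: norm_divide divide_le_eq)
  ultimately show False
    using permanent_nonzero by (simp add: poly_segment_poly)
qed

text \<open>
Along the segment from \<open>J\<close> to \<open>A\<close>, every factor \<open>1 - t * w i\<close> of the permanent stays within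
distance \<open>\<rho> < 1\<close> of \<open>1\<close>, so the sum of the principal logarithms is a continuous logarithm.
\<close>
lemma ln_permanent_eq_sum_Ln:
  assumes \<rho>: "0 < \<rho>" "\<rho> < 1" and A: "A \<in> matrix_polydisc n (\<rho> / 2)"
    and w: "segment_poly n A = Polynomial.smult (fact n) (\<Prod>i<n. [:1, - w i:])"
  shows "ln_permanent n A = of_real (ln (fact n)) + (\<Sum>i<n. Ln (1 - w i))"
proof -
  define h where "h t = of_real (ln (fact n)) + (\<Sum>i<n. Ln (1 - of_real t * w i))" for t :: real
  have small: "cmod (of_real t * w i) < 1" if "t \<in> {0..1}" "i < n" for t i
  proof -
    have "cmod (of_real t * w i) \<le> 1 * \<rho>"
      unfolding norm_mult using that inverse_root_bound[OF \<rho>(1) A w that(2)]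
      by (intro mult_mono) auto
    then show ?thesis using \<rho> by simp
  qed
  have slit: "1 - of_real t * w i \<notin> \<real>\<^sub>\<le>\<^sub>0" if "t \<in> {0..1}" "i < n" for t i
  proof -
    have "Re (of_real t * w i) < 1"
      using small[OF that] complex_Re_le_cmod[of "of_real t * w i"] by linarith
    then show ?thesis by (simp add: complex_nonpos_Reals_iff)
  qed
  have "ln_permanent n A = h 1"
  proof (rule branch_determined_by_path[OF is_ln_permanent_branch_ln_permanent])
    show "A \<in> matrix_polydisc n (1/2)"
      using A \<rho> by (force simp: matrix_polydisc_def)
    show "continuous_on {0..1} h"
      unfolding h_def by (intro continuous_intros ballI) (use slit in auto)
    show "h 0 = of_real (ln (fact n))" by (simp add: h_def)
    fix t :: real assume t: "t \<in> {0..1}"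
    have "exp (h t) = fact n * (\<Prod>i<n. exp (Ln (1 - of_real t * w i)))"
      by (simp add: h_def exp_add exp_sum exp_of_real)
    also have "(\<Prod>i<n. exp (Ln (1 - of_real t * w i))) = (\<Prod>i<n. 1 - of_real t * w i)"
      using slit[OF t] by (intro prod.cong refl exp_Ln) force
    also have "fact n * \<dots> = poly (segment_poly n A) (of_real t)"
      by (simp add: w poly_prod)
    finally show "exp (h t) = permanent (mat n n (segment_to A (of_real t)))"
      by (simp add: poly_segment_poly)
  qed
  then show ?thesis by (simp add: h_def)
qed

text \<open>
The approximation is the Taylor polynomial of degree \<open>m\<close> at \<open>t = 0\<close> of
\<open>ln per (J + t (A - J))\<close>, evaluated at \<open>t = 1\<close>. In terms of the inverse roots it is
\<open>ln n! - (\<Sum>k<m. (\<Sum>i<n. w i ^ Suc k) / Suc k)\<close>, so the error is the sum of \<open>n\<close> tails of the logarithmic series.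
\<close>
lemma ln_permanent_polynomial_approximation:
  assumes \<rho>: "0 < \<rho>" "\<rho> < 1"
  shows "\<exists>F. entry_polynomial n m F \<and>
    (\<forall>A \<in> matrix_polydisc n (\<rho> / 2). cmod (ln_permanent n A - F A) \<le> real n * (\<rho> ^ Suc m / (1 - \<rho>)))"
proof -
  have "\<exists>w. segment_poly n A = Polynomial.smult (fact n) (\<Prod>i<n. [:1, - w i:])" for A
    using complex_poly_factor_inverse_roots[of "segment_poly n A" n]
    by (simp add: poly_segment_poly_0 degree_segment_poly)
  then obtain w where w: "\<And>A. segment_poly n A = Polynomial.smult (fact n) (\<Prod>i<n. [:1, - w A i:])"
    by metis
  define F where "F A = of_real (ln (fact n)) +
    (\<Sum>k<m. (- (1 / of_nat (Suc k))) * (\<Sum>i<n. w A i ^ Suc k))" for A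
  have "entry_polynomial n m F"
    unfolding F_def
  proof (rule entry_polynomial_add[OF entry_polynomial_const entry_polynomial_sum], rule entry_polynomial_cmult)
    fix k assume "k \<in> {..<m}"
    then show "entry_polynomial n m (\<lambda>A. \<Sum>i<n. w A i ^ Suc k)"
      using entry_polynomial_power_sum[OF w, of k] by (rule_tac entry_polynomial_mono) auto
  qed
  moreover have "cmod (ln_permanent n A - F A) \<le> real n * (\<rho> ^ Suc m / (1 - \<rho>))"
    if A: "A \<in> matrix_polydisc n (\<rho> / 2)" for A
  proof -
    have "(\<Sum>k<m. (- (1 / of_nat (Suc k))) * (\<Sum>i<n. w A i ^ Suc k))
        = - (\<Sum>k<m. \<Sum>i<n. w A i ^ Suc k / of_nat (Suc k))"
      by (simp add: sum_distrib_left sum_negf[symmetric] sum_divide_distrib del: power_Suc of_nat_Suc)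
    also have "\<dots> = - (\<Sum>i<n. \<Sum>k<m. w A i ^ Suc k / of_nat (Suc k))"
      by (subst sum.swap) simp
    finally have "ln_permanent n A - F A
        = (\<Sum>i<n. Ln (1 - w A i) + (\<Sum>k<m. w A i ^ Suc k / of_nat (Suc k)))"
      unfolding F_def ln_permanent_eq_sum_Ln[OF \<rho> A w] by (simp add: sum.distrib del: power_Suc of_nat_Suc)
    also have "cmod \<dots> \<le> (\<Sum>i<n. \<rho> ^ Suc m / (1 - \<rho>))"
      using inverse_root_bound[OF \<rho>(1) A w] \<rho> by (intro sum_norm_le Ln_taylor_remainder) auto
    finally show ?thesis by simp
  qed
  ultimately show ?thesis by blast
qed

text \<open>
For \<open>n = 1\<close> the degree bound of the theorem tends to \<open>0\<close> as \<open>\<epsilon>\<close> tends to \<open>1\<close>, so that only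
constants remain. Because \<open>\<eta> / (1 - \<eta>) < 1\<close>, the constant \<open>0\<close> is then good enough.
\<close>
lemma norm_ln_permanent_1_le:
  assumes "\<eta> < 1/2" and A: "A \<in> matrix_polydisc 1 \<eta>"
  shows "cmod (ln_permanent 1 A) \<le> \<eta> / (1 - \<eta>)"
proof -
  have A': "A \<in> matrix_polydisc 1 (1/2)"
    using assms by (auto simp: matrix_polydisc_def)
  have a: "cmod (1 - A $$ (0, 0)) \<le> \<eta>" "A \<in> carrier_mat 1 1"
    using A by (auto simp: matrix_polydisc_def)
  have "permanent A = A $$ (0, 0)"
    using a(2) by (simp add: permanent_def)
  then have "ln_permanent 1 A = Ln (1 - (1 - A $$ (0, 0)))"
    unfolding ln_permanent_eq_row_log_sum[OF A'] using leading_rows_all[OF a(2)]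
    by (simp add: row_log_sum_def leading_rows_0 permanent_ones)
  then show ?thesis
    using Ln_taylor_remainder[OF a(1), of 0] assms(1) by simp
qed

theorem theorem1p5:
  fixes \<eta> :: real
  assumes "0 \<le> \<eta>" and "\<eta> < 1/2"
  shows "\<exists>\<gamma>::real. \<gamma> > 0 \<and>
    (\<forall>(n::nat) (\<epsilon>::real). n > 0 \<and> 0 < \<epsilon> \<and> \<epsilon> < 1 \<longrightarrow>
      (\<exists>p :: entry_poly.
        entry_poly_vars p \<subseteq> {0..<n} \<times> {0..<n} \<and>
        real (entry_poly_degree p) \<le> \<gamma> * (ln (real n) - ln \<epsilon>) \<and>
        (\<forall>A \<in> matrix_polydisc n \<eta>. cmod (ln_permanent n A - entry_poly_eval p A) \<le> \<epsilon>)))"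
proof -
  \<comment> \<open>Enlarging \<open>\<eta>\<close> makes the convergence ratio \<open>\<rho>\<close> positive, so that \<open>ln \<rho>\<close> is meaningful.\<close>
  define \<eta>' where "\<eta>' = max \<eta> (1/4)"
  define \<rho> where "\<rho> = 2 * \<eta>'"
  define \<theta> where "\<theta> = \<eta>' / (1 - \<eta>')"
  define K where "K = - ln (1 - \<rho>)"
  define c where "c = - ln \<rho>"
  \<comment> \<open>If \<open>ln n - ln \<epsilon> < x0\<close>, then \<open>n = 1\<close> and \<open>\<epsilon> > \<theta>\<close>: the polynomial \<open>0\<close> will do.\<close>
  define x0 where "x0 = min (ln 2) (- ln \<theta>)"
  \<comment> \<open>Chosen so that \<open>c * \<gamma> * x \<ge> x + K\<close> for \<open>x \<ge> x0\<close>, which makes the remainder at most \<open>\<epsilon>\<close>.\<close>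
  define \<gamma> where "\<gamma> = (1 + K / x0) / c"
  have \<eta>': "0 < \<eta>'" "\<eta>' < 1/2" "\<eta> \<le> \<eta>'" using assms by (auto simp: \<eta>'_def)
  have \<rho>: "0 < \<rho>" "\<rho> < 1" using \<eta>' by (auto simp: \<rho>_def)
  have \<theta>: "0 < \<theta>" "\<theta> < 1" using \<eta>' by (auto simp: \<theta>_def field_simps)
  have pos: "0 < K" "0 < c" "0 < x0" using \<rho> \<theta> by (auto simp: K_def c_def x0_def)
  then have \<gamma>: "0 < \<gamma>" by (simp add: \<gamma>_def add_pos_pos)
  have sub: "matrix_polydisc n \<eta> \<subseteq> matrix_polydisc n \<eta>'" for n
    using \<eta>'(3) by (force simp: matrix_polydisc_def)
  have "\<exists>p :: entry_poly. entry_poly_vars p \<subseteq> {0..<n} \<times> {0..<n} \<and>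
        real (entry_poly_degree p) \<le> \<gamma> * (ln (real n) - ln \<epsilon>) \<and>
        (\<forall>A \<in> matrix_polydisc n \<eta>. cmod (ln_permanent n A - entry_poly_eval p A) \<le> \<epsilon>)"
    if n: "n > 0" and \<epsilon>: "0 < \<epsilon>" "\<epsilon> < 1" for n :: nat and \<epsilon> :: real
  proof -
    define x where "x = ln (real n) - ln \<epsilon>"
    have "0 \<le> ln (real n)" "ln \<epsilon> < 0" using n \<epsilon> by auto
    then have x: "0 < x" by (simp add: x_def)
    show ?thesis
    proof (cases "x0 \<le> x")
      case True
      define m where "m = nat \<lfloor>\<gamma> * x\<rfloor>"
      have "0 \<le> \<gamma> * x" using \<gamma> x by simp
      then have m: "real m \<le> \<gamma> * x" "\<gamma> * x \<le> real (Suc m)"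
        unfolding m_def by linarith+
      obtain F where F: "entry_polynomial n m F"
          "\<And>A. A \<in> matrix_polydisc n (\<rho> / 2) \<Longrightarrow>
             cmod (ln_permanent n A - F A) \<le> real n * (\<rho> ^ Suc m / (1 - \<rho>))"
        using ln_permanent_polynomial_approximation[OF \<rho>, of n m] by blast
      obtain p where p: "entry_poly_vars p \<subseteq> {0..<n} \<times> {0..<n}" "entry_poly_degree p \<le> m"
          "\<And>A. entry_poly_eval p A = F A"
        using F(1) unfolding entry_polynomial_def by blast
      have "c * \<gamma> * x = x + K * (x / x0)"
        using pos by (simp add: \<gamma>_def field_simps)
      moreover have "K * 1 \<le> K * (x / x0)"
        using True pos by (intro mult_left_mono) auto
      moreover have "c * (\<gamma> * x) \<le> c * real (Suc m)"
        using m(2) pos by (intro mult_left_mono) auto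
      ultimately have "x + K \<le> c * real (Suc m)" by (simp add: mult.assoc)
      then have "exp (- (c * real (Suc m))) \<le> exp (ln \<epsilon> - ln (real n) + ln (1 - \<rho>))"
        by (simp add: x_def K_def)
      also have "\<dots> = \<epsilon> / real n * (1 - \<rho>)"
        using n \<epsilon> \<rho> by (simp add: exp_add exp_diff)
      also have "exp (- (c * real (Suc m))) = \<rho> ^ Suc m"
        using \<rho> by (simp add: c_def exp_of_nat2_mult del: of_nat_Suc power_Suc)
      finally have "real n * (\<rho> ^ Suc m / (1 - \<rho>)) \<le> \<epsilon>"
        using n \<rho> by (simp add: field_simps del: power_Suc)
      then have "cmod (ln_permanent n A - entry_poly_eval p A) \<le> \<epsilon>" if "A \<in> matrix_polydisc n \<eta>" for A
        using F(2)[of A] sub[of n] that by (auto simp: p(3) \<rho>_def)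
      moreover have "real (entry_poly_degree p) \<le> \<gamma> * (ln (real n) - ln \<epsilon>)"
        using p(2) m(1) by (simp add: x_def)
      ultimately show ?thesis using p(1) by blast
    next
      case False
      then have "ln (real n) < ln 2" "- ln \<epsilon> < - ln \<theta>"
        using \<open>0 \<le> ln (real n)\<close> \<open>ln \<epsilon> < 0\<close> by (auto simp: x_def x0_def)
      then have "n = 1" "\<theta> < \<epsilon>"
        using n \<epsilon> \<theta> by auto
      moreover have "cmod (ln_permanent 1 A) \<le> \<theta>" if "A \<in> matrix_polydisc 1 \<eta>" for A
        unfolding \<theta>_def using \<eta>' sub that by (intro norm_ln_permanent_1_le) auto
      ultimately have "cmod (ln_permanent n A) \<le> \<epsilon>" if "A \<in> matrix_polydisc n \<eta>" for A
        using that by force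
      then show ?thesis
        using \<gamma> x by (intro exI[of _ 0])
          (simp add: entry_poly_vars_def entry_poly_degree_def entry_poly_eval_def x_def[symmetric])
    qed
  qed
  then show ?thesis using \<gamma> by blast
qed

end
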